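(* Let $r\geq 2$ and $n\geq 3$ be integers. Then $s_r^*(n+1)\leq s_r^0(n)+1\leq s_r^*(n)+1$.
   Context: An $n$-partition of a positive integer $s$ is a multiset of $n$ positive integers summing to $s$. For a multiset $X=\{x_1,\dots,x_n\}$ of positive integers define $T(X)=(x_1+\cdots+x_n,\,x_1x_2\cdots x_n,\,n)$. For integers $r\geq2$ and $n\geq3$: $s_r^0(n)$ is the smallest positive integer $s$ such that there are at least $r$ different $n$-partitions $X_1,\dots,X_r$ of $s$ and a positive integer $p$ with $T(X_i)=(s,p,n)$ for all $i=1,\dots,r$; and $s_r^*(n)$ is the smallest positive integer such that for every integer $s\geq s_r^*(n)$ there are at least $r$ different $n$-partitions $X_1,\dots,X_r$ of $s$ and a positive integer $p$ (depending on $s$) with $T(X_i)=(s,p,n)$ for all $i=1,\dots,r$. (The quantities $s_r^0(n)$, $s_r^*(n)$ are taken to exist.) *)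

theory Defs
  imports Main "HOL-Library.Multiset"
begin

definition n_partition :: "nat \<Rightarrow> nat \<Rightarrow> nat multiset \<Rightarrow> bool" where
  "n_partition n s X \<longleftrightarrow> size X = n \<and> (\<forall>x\<in>#X. 0 < x) \<and> sum_mset X = s"

definition T :: "nat multiset \<Rightarrow> nat \<times> nat \<times> nat" where
  "T X = (sum_mset X, prod_mset X, size X)"

definition has_partitions :: "nat \<Rightarrow> nat \<Rightarrow> nat \<Rightarrow> bool" where
  "has_partitions r n s \<longleftrightarrow>
     (\<exists>(X :: nat \<Rightarrow> nat multiset) (p :: nat).
        0 < p \<and> inj_on X {1..r} \<and>
        (\<forall>i\<in>{1..r}. n_partition n s (X i) \<and> T (X i) = (s, p, n)))"

definition s0_prop :: "nat \<Rightarrow> nat \<Rightarrow> nat \<Rightarrow> bool" where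
  "s0_prop r n s \<longleftrightarrow> 0 < s \<and> has_partitions r n s"

definition sstar_prop :: "nat \<Rightarrow> nat \<Rightarrow> nat \<Rightarrow> bool" where
  "sstar_prop r n m \<longleftrightarrow> 0 < m \<and> (\<forall>s\<ge>m. has_partitions r n s)"

text \<open>As with any \<open>LEAST\<close>, the next two values are meaningful only if some number
  satisfies the respective predicate; existence is to be assumed where they are used.\<close>

definition s0 :: "nat \<Rightarrow> nat \<Rightarrow> nat" where
  "s0 r n = (LEAST s. s0_prop r n s)"

definition sstar :: "nat \<Rightarrow> nat \<Rightarrow> nat" where
  "sstar r n = (LEAST m. sstar_prop r n m)"

end

theory Submission
  imports Defs
begin

text \<open>Adjoining one common part \<open>k\<close> to \<open>r\<close> distinct partitions with
  equal sum and product keeps them distinct and preserves both equalities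
  (\<open>has_partitions_add_part\<close>). Starting from the least sum \<open>s0 r n\<close> and
  letting \<open>k\<close> run over all positive integers reaches every larger sum with
  \<open>n + 1\<close> parts. The second inequality is minimality of \<open>s0 r n\<close>.\<close>

lemma has_partitions_add_part:
  assumes "has_partitions r n s" "0 < k"
  shows "has_partitions r (n + 1) (s + k)"
proof -
  obtain X p where p: "0 < p" and inj: "inj_on X {1..r}"
    and X: "\<And>i. i \<in> {1..r} \<Longrightarrow> n_partition n s (X i) \<and> T (X i) = (s, p, n)"
    using assms(1) unfolding has_partitions_def by meson
  have "n_partition (n + 1) (s + k) (add_mset k (X i)) \<and>
      T (add_mset k (X i)) = (s + k, k * p, n + 1)" if "i \<in> {1..r}" for i
    using X[OF that] assms(2) by (simp add: n_partition_def T_def)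
  \<comment> \<open>Multiset addition is cancellative, so a common extra part cannot merge two
    partitions.\<close>
  moreover have "inj_on (\<lambda>i. add_mset k (X i)) {1..r}"
    by (rule inj_onI) (simp add: inj_on_eq_iff[OF inj])
  moreover have "0 < k * p"
    using p assms(2) by simp
  ultimately show ?thesis
    unfolding has_partitions_def
    by (intro exI[of _ "\<lambda>i. add_mset k (X i)"] exI[of _ "k * p"]) simp
qed

theorem theorem4p1:
  fixes r n :: nat
  assumes "2 \<le> r" and "3 \<le> n"
    and s0_exists: "\<exists>s. s0_prop r n s"
    and sstar_exists: "\<exists>m. sstar_prop r n m"
  shows "sstar r (n + 1) \<le> s0 r n + 1 \<and> s0 r n + 1 \<le> sstar r n + 1"
proof
  have "s0_prop r n (s0 r n)"
    unfolding s0_def by (rule LeastI_ex[OF s0_exists])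
  then have parts: "has_partitions r n (s0 r n)"
    by (simp add: s0_prop_def)
  have "has_partitions r (n + 1) s" if "s0 r n + 1 \<le> s" for s
    \<comment> \<open>The new part \<open>s - s0 r n\<close> must be positive, whence the
      \<open>+ 1\<close> in the bound.\<close>
    using has_partitions_add_part[OF parts, of "s - s0 r n"] that by simp
  then have "sstar_prop r (n + 1) (s0 r n + 1)"
    by (simp add: sstar_prop_def)
  then show "sstar r (n + 1) \<le> s0 r n + 1"
    unfolding sstar_def by (rule Least_le)
next
  have "sstar_prop r n (sstar r n)"
    unfolding sstar_def by (rule LeastI_ex[OF sstar_exists])
  \<comment> \<open>The threshold \<open>sstar r n\<close> is itself one of the sums it
    guarantees.\<close>
  then have "s0_prop r n (sstar r n)"
    by (simp add: sstar_prop_def s0_prop_def)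
  then have "s0 r n \<le> sstar r n"
    unfolding s0_def by (rule Least_le)
  then show "s0 r n + 1 \<le> sstar r n + 1"
    by simp
qed

end
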